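(* Let $\beta_1,\beta_2$ be non-constant complex rational functions, and let $K_1,K_2$ be subsets of $\mathbb{R}$ such that the intersection $\beta_1^{-1}(K_1)\cap\beta_2^{-1}(K_2)$ is infinite. Then there exist a rational function $W$ and rational functions $P_1,P_2$ with real coefficients such that $\beta_1=P_1\circ W$ and $\beta_2=P_2\circ W$.
   Context: Preimages are taken in the Riemann sphere $\mathbb{CP}^1$. *)

theory Defs
  imports "HOL-Analysis.Analysis" "HOL-Computational_Algebra.Computational_Algebra"
    "HOL-Computational_Algebra.Normalized_Fraction" "HOL-Computational_Algebra.Field_as_Ring"
begin

type_synonym ratfun = "complex poly fract"

text \<open>Points of the Riemann sphere CP^1: None is the point at infinity.\<close>
type_synonym sphere = "complex option"

definition const_ratfun :: "complex \<Rightarrow> ratfun" where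
  "const_ratfun c = to_fract [:c:]"

definition nonconstant_ratfun :: "ratfun \<Rightarrow> bool" where
  "nonconstant_ratfun f \<longleftrightarrow> (\<forall>c. f \<noteq> const_ratfun c)"

definition real_poly :: "complex poly \<Rightarrow> bool" where
  "real_poly p \<longleftrightarrow> (\<forall>i. coeff p i \<in> \<real>)"

definition real_ratfun :: "ratfun \<Rightarrow> bool" where
  "real_ratfun f \<longleftrightarrow> (\<exists>a b. b \<noteq> 0 \<and> real_poly a \<and> real_poly b \<and> f = Fract a b)"

definition poly_subst :: "complex poly \<Rightarrow> ratfun \<Rightarrow> ratfun" where
  "poly_subst p W = poly (map_poly const_ratfun p) W"

definition ratfun_comp :: "ratfun \<Rightarrow> ratfun \<Rightarrow> ratfun" where
  "ratfun_comp P W = (case quot_of_fract P of (a, b) \<Rightarrow> poly_subst a W / poly_subst b W)"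

text \<open>Evaluation of a rational function as a map CP^1 \<rightarrow> CP^1, via the reduced
  representation f = a/b (a, b coprime).\<close>
definition ratfun_eval :: "ratfun \<Rightarrow> sphere \<Rightarrow> sphere" where
  "ratfun_eval f z = (case quot_of_fract f of (a, b) \<Rightarrow>
     (case z of
        Some w \<Rightarrow> (if poly b w = 0 then None else Some (poly a w / poly b w))
      | None \<Rightarrow> (if degree a > degree b then None
                 else if degree a < degree b then Some 0
                 else Some (lead_coeff a / lead_coeff b))))"

definition ratfun_preimage :: "ratfun \<Rightarrow> real set \<Rightarrow> sphere set" where
  "ratfun_preimage f K = {z. \<exists>x\<in>K. ratfun_eval f z = Some (complex_of_real x)}"

end

theory Submission
  imports Defs
begin

text \<open>The rational functions \<open>f\<close> for which some rational function takes the values \<open>cnj (f s)\<close> at all but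
  finitely many points \<open>s\<close> of the common preimage form a subfield of \<open>C(z)\<close> containing the constants,
  \<open>\<beta>1\<close> and \<open>\<beta>2\<close>. By Lueroth's theorem it is generated by a single \<open>V\<close>. The conjugate of \<open>V\<close> generates
  the field as well, so by multiplicativity of degrees it is a fractional linear function of \<open>V\<close>. Hence
  the values of \<open>V\<close> lie on a circle, and a fractional linear change of \<open>V\<close> yields a generator \<open>W\<close> which
  is real on the common preimage. Functions which are real there then have real coefficients as
  functions of \<open>W\<close>.\<close>

subsection \<open>Constants and substitution\<close>

lemma const_ratfun_0 [simp]: "const_ratfun 0 = 0"
  by (simp add: const_ratfun_def)

lemma const_ratfun_1 [simp]: "const_ratfun 1 = 1"
  by (simp add: const_ratfun_def flip: one_pCons)

lemma const_ratfun_eq_iff [simp]: "const_ratfun a = const_ratfun b \<longleftrightarrow> a = b"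
  by (simp add: const_ratfun_def)

lemma const_ratfun_add: "const_ratfun (a + b) = const_ratfun a + const_ratfun b"
  by (simp add: const_ratfun_def flip: to_fract_add)

lemma const_ratfun_uminus: "const_ratfun (- a) = - const_ratfun a"
  by (simp add: const_ratfun_def flip: to_fract_uminus)

lemma const_ratfun_mult: "const_ratfun (a * b) = const_ratfun a * const_ratfun b"
  by (simp add: const_ratfun_def flip: to_fract_mult)

lemma const_ratfun_eq_0_iff [simp]: "const_ratfun a = 0 \<longleftrightarrow> a = 0"
  by (simp add: const_ratfun_def)

lemma const_ratfun_divide: "const_ratfun (a / b) = const_ratfun a / const_ratfun b"
proof (cases "b = 0")
  case False
  have "const_ratfun (a / b) * const_ratfun b = const_ratfun a"
    using False by (simp flip: const_ratfun_mult)
  thus ?thesis using False by (simp add: field_simps)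
qed simp

lemma to_fract_smult: "to_fract (smult c p) = const_ratfun c * to_fract p"
  by (simp add: const_ratfun_def flip: to_fract_mult)

lemma to_fract_power: "to_fract (p ^ n) = to_fract p ^ n"
  by (induction n) simp_all

lemma poly_subst_0 [simp]: "poly_subst 0 W = 0"
  by (simp add: poly_subst_def)

lemma poly_subst_pCons [simp]:
  "poly_subst (pCons a p) W = const_ratfun a + W * poly_subst p W"
  by (simp add: poly_subst_def map_poly_pCons)

lemma poly_subst_add: "poly_subst (p + q) W = poly_subst p W + poly_subst q W"
proof -
  have "map_poly const_ratfun (p + q) = map_poly const_ratfun p + map_poly const_ratfun q"
    by (intro poly_eqI) (simp add: coeff_map_poly const_ratfun_add)
  thus ?thesis by (simp add: poly_subst_def)
qed

lemma poly_subst_smult: "poly_subst (smult c p) W = const_ratfun c * poly_subst p W"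
  by (simp add: poly_subst_def map_poly_smult const_ratfun_mult)

lemma poly_subst_mult: "poly_subst (p * q) W = poly_subst p W * poly_subst q W"
  by (induction p) (simp_all add: poly_subst_add poly_subst_smult algebra_simps)

lemma poly_subst_identity: "poly_subst p (to_fract [:0, 1:]) = to_fract p"
proof (induction p)
  case (pCons a p)
  have "pCons a p = [:a:] + [:0, 1:] * p" by simp
  hence "to_fract (pCons a p) = const_ratfun a + to_fract [:0, 1:] * to_fract p"
    by (simp only: to_fract_add to_fract_mult const_ratfun_def)
  thus ?case using pCons by simp
qed simp

lemma poly_eq_sum_upto:
  fixes p :: "'a :: comm_semiring_1 poly"
  assumes "degree p \<le> n"
  shows "poly p x = (\<Sum>i\<le>n. coeff p i * x ^ i)"
  unfolding poly_altdef
  using assms by (intro sum.mono_neutral_left) (auto simp: coeff_eq_0)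

lemma poly_subst_altdef:
  assumes "degree p \<le> n"
  shows "poly_subst p W = (\<Sum>i\<le>n. const_ratfun (coeff p i) * W ^ i)"
proof -
  have "degree (map_poly const_ratfun p) \<le> n"
    using map_poly_degree_leq[of const_ratfun p] assms by simp
  hence "poly (map_poly const_ratfun p) W = (\<Sum>i\<le>n. coeff (map_poly const_ratfun p) i * W ^ i)"
    by (rule poly_eq_sum_upto)
  thus ?thesis by (simp add: poly_subst_def coeff_map_poly)
qed

text \<open>Over the complex numbers \<open>p\<close> splits into linear factors, and each factor
  becomes some \<open>V - r\<close>, which is nonzero; thus \<open>V\<close> is transcendental over
  the constants.\<close>

lemma poly_subst_eq_0_iff:
  assumes "nonconstant_ratfun V"
  shows "poly_subst p V = 0 \<longleftrightarrow> p = 0"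
proof
  show "p = 0" if "poly_subst p V = 0"
    using that
  proof (induction "degree p" arbitrary: p rule: less_induct)
    case less
    show ?case
    proof (cases "degree p = 0")
      case True
      then obtain c where "p = [:c:]" by (elim degree_eq_zeroE)
      thus ?thesis using less.prems by simp
    next
      case False
      then obtain r where "poly p r = 0"
        using fundamental_theorem_of_algebra[of p] by (auto simp: constant_degree)
      then obtain q where q: "p = [:-r, 1:] * q"
        by (auto simp: poly_eq_0_iff_dvd)
      have "V \<noteq> const_ratfun r" using assms by (simp add: nonconstant_ratfun_def)
      hence "poly_subst q V = 0"
        using less.prems unfolding q poly_subst_mult by (simp add: const_ratfun_uminus)
      moreover have "degree q < degree p"
        using False unfolding q by (cases "q = 0") (simp_all del: mult_pCons_left add: degree_mult_eq)
      ultimately have "q = 0" by (rule less.hyps[rotated])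
      thus ?thesis by (simp add: q)
    qed
  qed
qed simp

subsection \<open>The degree of a rational function\<close>

text \<open>Over the complex numbers a nonconstant gcd has a root.\<close>

lemma coprime_poly_complex_iff:
  fixes p q :: "complex poly"
  shows "coprime p q \<longleftrightarrow> (\<forall>x. poly p x \<noteq> 0 \<or> poly q x \<noteq> 0)"
proof
  assume "coprime p q"
  show "\<forall>x. poly p x \<noteq> 0 \<or> poly q x \<noteq> 0"
  proof (rule ccontr)
    assume "\<not> ?thesis"
    then obtain x where "[:-x, 1:] dvd p" "[:-x, 1:] dvd q" by (auto simp: poly_eq_0_iff_dvd)
    hence "is_unit [:-x, 1:]" using \<open>coprime p q\<close> by (rule coprime_common_divisor[rotated])
    thus False by (simp add: is_unit_pCons_iff)
  qed
next
  assume *: "\<forall>x. poly p x \<noteq> 0 \<or> poly q x \<noteq> 0"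
  have "degree (gcd p q) = 0"
  proof (rule ccontr)
    assume "degree (gcd p q) \<noteq> 0"
    then obtain r where "poly (gcd p q) r = 0"
      using fundamental_theorem_of_algebra[of "gcd p q"] by (auto simp: constant_degree)
    hence "[:-r, 1:] dvd p" "[:-r, 1:] dvd q" by (auto simp: poly_eq_0_iff_dvd)
    thus False using * by (auto simp: poly_eq_0_iff_dvd)
  qed
  moreover have "gcd p q \<noteq> 0" using * by auto
  ultimately have "is_unit (gcd p q)" by (subst is_unit_iff_degree)
  thus "coprime p q" by (simp only: is_unit_gcd)
qed

text \<open>The degree of a nonconstant \<open>f\<close> as a self-map of the Riemann sphere, which
  is multiplicative under composition.\<close>

definition ratdeg :: "ratfun \<Rightarrow> nat" where
  "ratdeg f = max (degree (fst (quot_of_fract f))) (degree (snd (quot_of_fract f)))"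

lemma quot_of_fract_divide_to_fract:
  "f = to_fract (fst (quot_of_fract f)) / to_fract (snd (quot_of_fract f))"
  by (metis Fract_conv_to_fract Fract_quot_of_fract)

lemma degree_normalize_eq: "degree (normalize p) = degree (p :: complex poly)"
  by (cases "p = 0") (auto simp: normalize_poly_eq_map_poly map_poly_degree_eq)

text \<open>Two reduced representations of one fraction agree up to units, so any of them gives the
  degree.\<close>

lemma ratdeg_eq:
  assumes "coprime a b" "b \<noteq> 0"
  shows "ratdeg (to_fract a / to_fract b) = max (degree a) (degree b)"
proof -
  define f where "f = to_fract a / to_fract b"
  define c d where "c = fst (quot_of_fract f)" and "d = snd (quot_of_fract f)"
  have d: "d \<noteq> 0" "coprime c d" by (auto simp: c_def d_def coprime_quot_of_fract)
  have "to_fract a / to_fract b = to_fract c / to_fract d"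
    using quot_of_fract_divide_to_fract[of f] by (simp add: c_def d_def f_def)
  hence "to_fract (a * d) = to_fract (c * b)" using d assms by (simp add: field_simps)
  hence "a * d = c * b" by (simp only: to_fract_eq_iff)
  hence "normalize a * normalize d = normalize c * normalize b"
    by (metis normalize_mult)
  hence "normalize a = normalize c \<and> normalize b = normalize d"
    using coprime_crossproduct[of a b c d] d assms by (auto simp: coprime_commute)
  hence "degree a = degree c" "degree b = degree d" by (metis degree_normalize_eq)+
  thus ?thesis by (simp add: ratdeg_def c_def d_def f_def)
qed

lemma ratfun_coprime_rep:
  obtains a b where "coprime a b" "b \<noteq> 0" "f = to_fract a / to_fract b"
    "ratdeg f = max (degree a) (degree b)"
  using that[OF coprime_quot_of_fract snd_quot_of_fract_nonzero
    quot_of_fract_divide_to_fract ratdeg_def] .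

lemma nonconstant_ratfun_iff_ratdeg: "nonconstant_ratfun f \<longleftrightarrow> ratdeg f \<noteq> 0"
proof -
  obtain a b where ab: "coprime a b" "b \<noteq> 0" "f = to_fract a / to_fract b"
    "ratdeg f = max (degree a) (degree b)" by (rule ratfun_coprime_rep)
  show ?thesis
  proof
    assume nc: "nonconstant_ratfun f"
    show "ratdeg f \<noteq> 0"
    proof
      assume "ratdeg f = 0"
      then obtain c d where "a = [:c:]" "b = [:d:]"
        using ab(4) by (metis degree_eq_zeroE max_0_1(1) max.cobounded1 max.cobounded2 le_zero_eq)
      hence "f = const_ratfun (c / d)" unfolding ab(3) const_ratfun_divide by (simp add: const_ratfun_def)
      thus False using nc by (simp add: nonconstant_ratfun_def)
    qed
  next
    assume "ratdeg f \<noteq> 0"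
    moreover have "ratdeg (const_ratfun c) = 0" for c by (simp add: ratdeg_def const_ratfun_def)
    ultimately show "nonconstant_ratfun f" by (auto simp: nonconstant_ratfun_def)
  qed
qed

text \<open>The bounds \<open>m\<close> and \<open>n\<close> may exceed the actual degrees: of two
  polynomials with a common degree bound, perhaps only one attains it.\<close>

lemma coeff_mult_top:
  assumes "degree p \<le> m" "degree q \<le> n"
  shows "coeff (p * q) (m + n) = coeff p m * coeff q n"
proof -
  have "coeff (p * q) (m + n) = (\<Sum>i\<le>m + n. if i = m then coeff p m * coeff q n else 0)"
    unfolding coeff_mult
  proof (intro sum.cong refl)
    fix i assume "i \<in> {..m + n}"
    show "coeff p i * coeff q (m + n - i) = (if i = m then coeff p m * coeff q n else 0)"
    proof (cases i m rule: linorder_cases)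
      case less
      hence "coeff q (m + n - i) = 0" using assms by (intro coeff_eq_0) simp
      thus ?thesis using less by simp
    next
      case greater
      hence "coeff p i = 0" using assms by (intro coeff_eq_0) simp
      thus ?thesis using greater by simp
    qed simp
  qed
  thus ?thesis by simp
qed

lemma coeff_power_top:
  fixes p :: "'a :: comm_semiring_1 poly"
  assumes "degree p \<le> m"
  shows "degree (p ^ i) \<le> i * m" "coeff (p ^ i) (i * m) = coeff p m ^ i"
proof -
  show *: "degree (p ^ i) \<le> i * m" for i
    using order_trans[OF degree_power_le[of p i] mult_le_mono1[OF assms]] by (simp add: mult.commute)
  show "coeff (p ^ i) (i * m) = coeff p m ^ i"
    by (induction i) (simp_all add: coeff_mult_top assms *)
qed

text \<open>The binary form of degree \<open>n\<close> belonging to \<open>p\<close>, at the point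
  \<open>(a, b)\<close>; that is, b^n p(a/b) written without division.\<close>

definition homogenize :: "nat \<Rightarrow> complex poly \<Rightarrow> complex poly \<Rightarrow> complex poly \<Rightarrow> complex poly" where
  "homogenize n p a b = (\<Sum>i\<le>n. smult (coeff p i) (a ^ i * b ^ (n - i)))"

lemma to_fract_homogenize:
  assumes "degree p \<le> n" "b \<noteq> 0"
  shows "to_fract (homogenize n p a b) = to_fract b ^ n * poly_subst p (to_fract a / to_fract b)"
proof -
  have "to_fract (homogenize n p a b) =
          (\<Sum>i\<le>n. const_ratfun (coeff p i) * (to_fract a ^ i * to_fract b ^ (n - i)))"
    by (simp add: homogenize_def to_fract_smult to_fract_power)
  also have "\<dots> = (\<Sum>i\<le>n. to_fract b ^ n * (const_ratfun (coeff p i) * (to_fract a / to_fract b) ^ i))"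
    using assms(2) by (intro sum.cong refl) (simp add: power_divide power_diff)
  finally show ?thesis
    by (simp add: poly_subst_altdef[OF assms(1)] sum_distrib_left)
qed

text \<open>For nonzero \<open>y\<close> a common zero would give the common root
  \<open>x / y\<close>. At \<open>y = 0\<close>, the point at infinity, the forms reduce to the
  coefficients at \<open>n\<close> times x^n, and one of these coefficients is a leading
  one.\<close>

lemma homogeneous_forms_no_common_zero:
  fixes p q :: "complex poly"
  assumes "coprime p q" "n = max (degree p) (degree q)" "x \<noteq> 0 \<or> y \<noteq> 0"
  shows "(\<Sum>i\<le>n. coeff p i * (x ^ i * y ^ (n - i))) \<noteq> 0 \<or>
         (\<Sum>i\<le>n. coeff q i * (x ^ i * y ^ (n - i))) \<noteq> 0"
proof (cases "y = 0")
  case True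
  have "(\<Sum>i\<le>n. coeff r i * (x ^ i * y ^ (n - i))) = coeff r n * x ^ n" for r
  proof -
    have "(\<Sum>i\<le>n. coeff r i * (x ^ i * y ^ (n - i))) = (\<Sum>i\<le>n. if i = n then coeff r n * x ^ n else 0)"
      using True by (intro sum.cong) (auto simp: power_0_left)
    thus ?thesis by simp
  qed
  moreover have "coeff p n \<noteq> 0 \<or> coeff q n \<noteq> 0"
  proof -
    have "p \<noteq> 0 \<or> q \<noteq> 0" using assms(1) by auto
    thus ?thesis using assms(2)
      by (metis degree_0 leading_coeff_0_iff max_0L max_0R max_def)
  qed
  ultimately show ?thesis using True assms(3) by auto
next
  case False
  have "(\<Sum>i\<le>n. coeff r i * (x ^ i * y ^ (n - i))) = y ^ n * poly r (x / y)" if "degree r \<le> n" for r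
    unfolding poly_eq_sum_upto[OF that] sum_distrib_left
    using False by (intro sum.cong) (auto simp: power_divide power_diff)
  moreover have "poly p (x / y) \<noteq> 0 \<or> poly q (x / y) \<noteq> 0"
    using assms(1) by (simp add: coprime_poly_complex_iff)
  ultimately show ?thesis using False assms(2) by auto
qed

text \<open>Homogenizing numerator and denominator keeps them coprime, since \<open>a\<close> and
  \<open>b\<close> never vanish together and the two forms have no common zero elsewhere. The same
  argument at infinity, with the coefficients at \<open>d\<close>, shows that no degree is
  lost.\<close>

theorem ratdeg_compose:
  assumes "coprime p q" "q \<noteq> 0" "nonconstant_ratfun V"
  shows "ratdeg (poly_subst p V / poly_subst q V) = max (degree p) (degree q) * ratdeg V"
proof -
  obtain a b where ab: "coprime a b" "b \<noteq> 0" "V = to_fract a / to_fract b"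
    "ratdeg V = max (degree a) (degree b)" by (rule ratfun_coprime_rep)
  define n where "n = max (degree p) (degree q)"
  define d where "d = max (degree a) (degree b)"
  define P Q where "P = homogenize n p a b" and "Q = homogenize n q a b"
  have PQ: "to_fract P = to_fract b ^ n * poly_subst p V" "to_fract Q = to_fract b ^ n * poly_subst q V"
    unfolding P_def Q_def ab(3) by (intro to_fract_homogenize ab(2); simp add: n_def)+
  have "to_fract Q \<noteq> 0" using assms ab unfolding PQ by (simp add: poly_subst_eq_0_iff)
  hence "Q \<noteq> 0" by simp
  have eval: "poly (homogenize n r a b) x =
    (\<Sum>i\<le>n. coeff r i * (poly a x ^ i * poly b x ^ (n - i)))" for r x
    by (simp add: homogenize_def poly_sum)
  have "coprime P Q"
    unfolding coprime_poly_complex_iff P_def Q_def eval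
    using homogeneous_forms_no_common_zero[OF assms(1) n_def] ab(1) coprime_poly_complex_iff by blast
  have deg: "degree (homogenize n r a b) \<le> n * d"
    and top: "coeff (homogenize n r a b) (n * d) =
      (\<Sum>i\<le>n. coeff r i * (coeff a d ^ i * coeff b d ^ (n - i)))" for r
  proof -
    have *: "degree (a ^ i) \<le> i * d" "degree (b ^ i) \<le> i * d"
       "coeff (a ^ i) (i * d) = coeff a d ^ i" "coeff (b ^ i) (i * d) = coeff b d ^ i" for i
      by (intro coeff_power_top; simp add: d_def)+
    have nd: "i * d + (n - i) * d = n * d" if "i \<le> n" for i
      using that by (simp flip: add_mult_distrib)
    have "degree (a ^ i * b ^ (n - i)) \<le> n * d" if "i \<le> n" for i
      using degree_mult_le[of "a ^ i" "b ^ (n - i)"] *(1)[of i] *(2)[of "n - i"] nd[OF that] by linarith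
    thus "degree (homogenize n r a b) \<le> n * d"
      unfolding homogenize_def by (intro degree_sum_le) (auto intro: order_trans[OF degree_smult_le])
    have "coeff (a ^ i * b ^ (n - i)) (n * d) = coeff a d ^ i * coeff b d ^ (n - i)" if "i \<le> n" for i
      using coeff_mult_top[OF *(1)[of i] *(2)[of "n - i"]] * nd[OF that] by simp
    thus "coeff (homogenize n r a b) (n * d) =
        (\<Sum>i\<le>n. coeff r i * (coeff a d ^ i * coeff b d ^ (n - i)))"
      by (simp add: homogenize_def coeff_sum)
  qed
  have "coeff a d \<noteq> 0 \<or> coeff b d \<noteq> 0"
    using ab(1,2) unfolding d_def
    by (metis degree_0 leading_coeff_0_iff max_0L max_def)
  from homogeneous_forms_no_common_zero[OF assms(1) n_def this]
  have "coeff P (n * d) \<noteq> 0 \<or> coeff Q (n * d) \<noteq> 0" by (simp add: P_def Q_def top)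
  hence "max (degree P) (degree Q) = n * d"
    using deg[of p] deg[of q] le_degree[of P "n * d"] le_degree[of Q "n * d"]
    unfolding P_def Q_def by linarith
  moreover have "poly_subst p V / poly_subst q V = to_fract P / to_fract Q"
    using ab(2) by (simp add: PQ)
  ultimately show ?thesis
    using ratdeg_eq[OF \<open>coprime P Q\<close> \<open>Q \<noteq> 0\<close>] ab(4) by (simp add: n_def d_def)
qed

subsection \<open>Linear dependence by counting\<close>

text \<open>Gaussian elimination: a pivot \<open>f j\<close> with nonzero top coefficient clears
  this coefficient from the other polynomials, and the bound and the size of the family both drop by
  one. Without a pivot only the bound drops.\<close>

lemma poly_family_linearly_dependent:
  fixes f :: "'i \<Rightarrow> 'a :: field poly"
  assumes "finite I" "D < card I" "\<And>i k. i \<in> I \<Longrightarrow> k \<ge> D \<Longrightarrow> coeff (f i) k = 0"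
  shows "\<exists>x. (\<exists>i\<in>I. x i \<noteq> 0) \<and> (\<Sum>i\<in>I. smult (x i) (f i)) = 0"
  using assms
proof (induction D arbitrary: I f)
  case 0
  have "f i = 0" if "i \<in> I" for i using that 0 by (intro poly_eqI) simp
  hence "(\<Sum>i\<in>I. smult 1 (f i)) = 0" by simp
  moreover have "I \<noteq> {}" using 0 by auto
  ultimately show ?case by (intro exI[of _ "\<lambda>_. 1"]) auto
next
  case (Suc D)
  show ?case
  proof (cases "\<forall>i\<in>I. coeff (f i) D = 0")
    case True
    hence "coeff (f i) k = 0" if "i \<in> I" "k \<ge> D" for i k
      using that Suc.prems(3)[of i k] by (cases "k = D") auto
    thus ?thesis using Suc.IH[of I f] Suc.prems by simp
  next
    case False
    then obtain j where j: "j \<in> I" "coeff (f j) D \<noteq> 0" by auto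
    define r where "r i = coeff (f i) D / coeff (f j) D" for i
    define g where "g i = f i - smult (r i) (f j)" for i
    have "coeff (g i) k = 0" if "i \<in> I - {j}" "k \<ge> D" for i k
      using that j Suc.prems(3)[of i k] Suc.prems(3)[of j k]
      by (cases "k = D") (auto simp: g_def r_def)
    moreover have "D < card (I - {j})" using Suc.prems j by simp
    ultimately obtain x where x: "\<exists>i\<in>I - {j}. x i \<noteq> 0" "(\<Sum>i\<in>I - {j}. smult (x i) (g i)) = 0"
      using Suc.IH[of "I - {j}" g] Suc.prems(1) by auto
    \<comment> \<open>The pivot's coefficient absorbs the multiples of \<open>f j\<close> that were
      subtracted in the \<open>g i\<close>.\<close>
    define y where "y i = (if i = j then - (\<Sum>i\<in>I - {j}. x i * r i) else x i)" for i
    have "(\<Sum>i\<in>I. smult (y i) (f i)) = smult (y j) (f j) + (\<Sum>i\<in>I - {j}. smult (y i) (f i))"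
      using Suc.prems(1) j(1) by (rule sum.remove)
    also have "(\<Sum>i\<in>I - {j}. smult (y i) (f i)) = (\<Sum>i\<in>I - {j}. smult (x i) (f i))"
      by (intro sum.cong) (auto simp: y_def)
    also have "smult (y j) (f j) = - (\<Sum>i\<in>I - {j}. smult (x i * r i) (f j))"
      by (simp add: y_def smult_sum)
    also have "\<dots> + (\<Sum>i\<in>I - {j}. smult (x i) (f i)) = (\<Sum>i\<in>I - {j}. smult (x i) (g i))"
      by (simp add: g_def smult_diff_right sum_subtractf)
    finally have "(\<Sum>i\<in>I. smult (y i) (f i)) = 0" using x(2) by simp
    moreover have "\<exists>i\<in>I. y i \<noteq> 0" using x(1) by (auto simp: y_def)
    ultimately show ?thesis by blast
  qed
qed

subsection \<open>Lueroth's theorem\<close>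

text \<open>With both scalars nonzero, \<open>a\<close> and \<open>b\<close> would have the same
  roots; one of them is nonconstant and has a root, against coprimality.\<close>

lemma coprime_pencil_eq:
  fixes a b :: "complex poly"
  assumes "coprime a b" "degree a \<noteq> 0 \<or> degree b \<noteq> 0" "smult x b = smult y a"
  shows "x = 0 \<and> y = 0"
proof -
  have "a \<noteq> 0" "b \<noteq> 0" using assms(1,2) by (auto simp: is_unit_poly_iff)
  hence "x = 0" if "y = 0" using that assms(3) by simp
  moreover have "y = 0" if "x = 0" using that assms(3) \<open>a \<noteq> 0\<close> by auto
  moreover have False if "x \<noteq> 0" "y \<noteq> 0"
  proof -
    have "poly a r = 0 \<longleftrightarrow> poly b r = 0" for r
      using arg_cong[OF assms(3), of "\<lambda>p. poly p r"] that by auto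
    moreover obtain r where "poly a r = 0 \<or> poly b r = 0"
      using assms(2) fundamental_theorem_of_algebra[of a] fundamental_theorem_of_algebra[of b]
      by (auto simp: constant_degree)
    ultimately show False using assms(1) by (auto simp: coprime_poly_complex_iff)
  qed
  ultimately show ?thesis by auto
qed

text \<open>Both \<open>ratfun_comp\<close> and \<open>ratdeg_compose\<close> work with a reduced
  fraction; this passes to one from any pair \<open>A\<close>, \<open>B\<close>.\<close>

lemma poly_subst_quot_of_fract:
  assumes "nonconstant_ratfun V" "B \<noteq> 0" "poly_subst B V * u = poly_subst A V"
  shows "u = poly_subst (fst (quot_of_fract (Fract A B))) V / poly_subst (snd (quot_of_fract (Fract A B))) V"
proof -
  define c d where "c = fst (quot_of_fract (Fract A B))" and "d = snd (quot_of_fract (Fract A B))"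
  have d: "d \<noteq> 0" by (simp add: d_def)
  have "Fract c d = Fract A B" by (simp add: c_def d_def)
  hence "c * B = A * d" using d assms(2) by (simp add: eq_fract)
  hence "poly_subst c V * poly_subst B V = poly_subst B V * u * poly_subst d V"
    unfolding assms(3) by (simp flip: poly_subst_mult)
  hence "u = poly_subst c V / poly_subst d V"
    using d assms(1,2) by (simp add: poly_subst_eq_0_iff field_simps)
  thus ?thesis by (simp only: c_def d_def)
qed

section \<open>Polynomials in two variables and the polynomial b(z) a(T) - a(z) b(T)\<close>

lemma coeff_poly_const:
  "coeff (poly g [:t:]) j = poly (map_poly (\<lambda>p. coeff p j) g) t"
  by (induction g) (simp_all add: map_poly_pCons)

text \<open>In \<open>f \<in> C[z][T]\<close> the outer variable is \<open>T\<close>, and \<open>f(z, t)\<close> is \<open>poly f [:t:]\<close>.\<close>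
definition cross_poly :: "complex poly \<Rightarrow> complex poly \<Rightarrow> complex poly poly" where
  "cross_poly a b = smult b (map_poly (\<lambda>c. [:c:]) a) - smult a (map_poly (\<lambda>c. [:c:]) b)"

lemma coeff_cross_poly: "coeff (cross_poly a b) i = smult (coeff a i) b - smult (coeff b i) a"
  by (simp add: cross_poly_def coeff_map_poly)

lemma poly_lift_const: "poly (map_poly (\<lambda>c. [:c:]) p) [:t:] = [:poly p t:]"
  by (induction p) (simp_all add: map_poly_pCons mult.commute)

lemma poly_cross_poly: "poly (cross_poly a b) [:t:] = smult (poly a t) b - smult (poly b t) a"
  by (simp add: cross_poly_def poly_lift_const)

text \<open>The coefficient of T^d, for d the larger degree, is a nontrivial combination of
  \<open>a\<close> and \<open>b\<close>, which are linearly independent.\<close>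

lemma degree_cross_poly:
  assumes "coprime a b" "degree a \<noteq> 0 \<or> degree b \<noteq> 0"
  shows "degree (cross_poly a b) = max (degree a) (degree b)"
proof (rule antisym)
  show "degree (cross_poly a b) \<le> max (degree a) (degree b)"
    by (rule degree_le) (auto simp: coeff_cross_poly coeff_eq_0)
  have "coeff (cross_poly a b) (max (degree a) (degree b)) \<noteq> 0"
  proof
    assume "coeff (cross_poly a b) (max (degree a) (degree b)) = 0"
    hence "coeff a (max (degree a) (degree b)) = 0 \<and> coeff b (max (degree a) (degree b)) = 0"
      unfolding coeff_cross_poly by (intro coprime_pencil_eq[OF assms]) simp
    thus False using assms(2) by (auto simp: max_def split: if_splits)
  qed
  thus "max (degree a) (degree b) \<le> degree (cross_poly a b)" by (rule le_degree)
qed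

text \<open>Any divisor of \<open>b(z) a(T) - a(z) b(T)\<close> of full degree in \<open>z\<close> is the whole polynomial up to a
  constant: a nonconstant cofactor of degree 0 in \<open>z\<close> has a root \<open>T = t\<close>, but \<open>a(t) b - b(t) a\<close> never vanishes.\<close>
lemma degree_divisor_cross_poly:
  assumes ab: "coprime a b" "degree a \<noteq> 0 \<or> degree b \<noteq> 0"
    and g: "g dvd cross_poly a b" "max (degree a) (degree b) \<le> degree (coeff g i)"
  shows "degree g = max (degree a) (degree b)"
proof -
  define d where "d = max (degree a) (degree b)"
  define F where "F = cross_poly a b"
  have d0: "d > 0" using ab(2) by (auto simp: d_def)
  from g(1) obtain q where q: "F = g * q" by (auto simp: F_def)
  \<comment> \<open>Bivariate polynomials are now also read by powers of z: \<open>col j p\<close>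
    is the coefficient of z^j, a polynomial in T.\<close>
  define col where "col j = map_poly (\<lambda>p :: complex poly. coeff p j)" for j
  have coeff_col: "coeff (col j p) k = coeff (coeff p k) j" for j p k
    by (simp add: col_def coeff_map_poly)
  define j where "j = degree (coeff g i)"
  have "d \<le> j" using g(2) by (simp add: d_def j_def)
  have "coeff g i \<noteq> 0" using d0 \<open>d \<le> j\<close> by (auto simp: j_def)
  hence "coeff (col j g) i \<noteq> 0" by (simp add: coeff_col j_def)
  hence "col j g \<noteq> 0" by auto
  hence fin: "finite {t. poly (col j g) t = 0}" by (rule poly_roots_finite)
  have F_nz: "poly F [:t:] \<noteq> 0" for t
  proof
    assume "poly F [:t:] = 0"
    hence "poly a t = 0 \<and> poly b t = 0"
      unfolding F_def poly_cross_poly by (intro coprime_pencil_eq[OF ab]) simp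
    thus False using ab(1) by (auto simp: coprime_poly_complex_iff)
  qed
  \<comment> \<open>For all but finitely many \<open>t\<close>, g(z, t) already uses up the whole
    degree in z that is available to F(z, t).\<close>
  have deg_q: "degree (poly q [:t:]) = 0" if "poly (col j g) t \<noteq> 0" for t
  proof -
    have "coeff (poly g [:t:]) j \<noteq> 0" using that by (simp add: coeff_poly_const col_def)
    hence "d \<le> degree (poly g [:t:])" using \<open>d \<le> j\<close> le_degree order_trans by blast
    moreover have "degree (poly F [:t:]) = degree (poly g [:t:]) + degree (poly q [:t:])"
      using F_nz[of t] unfolding q by (simp add: degree_mult_eq)
    moreover have "degree (poly F [:t:]) \<le> d"
      unfolding F_def poly_cross_poly d_def
      by (intro degree_diff_le order_trans[OF degree_smult_le]) auto
    ultimately show ?thesis by linarith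
  qed
  \<comment> \<open>A polynomial in T with infinitely many zeros vanishes, so the cofactor
    \<open>q\<close> involves T only.\<close>
  have col_q: "col k q = 0" if "k > 0" for k
  proof (rule ccontr)
    assume "col k q \<noteq> 0"
    hence "finite {t. poly (col k q) t = 0}" by (rule poly_roots_finite)
    moreover have "- {t. poly (col j g) t = 0} \<subseteq> {t. poly (col k q) t = 0}"
    proof (clarify, rule ccontr)
      fix t assume "poly (col k q) t \<noteq> 0" "poly (col j g) t \<noteq> 0"
      thus False using deg_q[of t] coeff_eq_0[of "poly q [:t:]" k] that
        by (simp add: coeff_poly_const col_def)
    qed
    ultimately have "finite (- {t. poly (col j g) t = 0})" by (rule finite_subset[rotated])
    thus False using fin infinite_UNIV_char_0 by (metis Compl_partition finite_UnI)
  qed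
  have "F \<noteq> 0" using F_nz[of 0] by auto
  hence "g \<noteq> 0" "q \<noteq> 0" by (auto simp: q)
  have "degree q = 0"
  proof (rule ccontr)
    assume "degree q \<noteq> 0"
    have "coeff (lead_coeff q) 0 \<noteq> 0"
    proof
      assume "coeff (lead_coeff q) 0 = 0"
      hence "coeff (lead_coeff q) k = 0" for k
        using col_q[of k] by (cases "k = 0") (simp_all flip: coeff_col)
      hence "lead_coeff q = 0" by (intro poly_eqI) simp
      thus False using \<open>q \<noteq> 0\<close> by simp
    qed
    hence "degree q \<le> degree (col 0 q)" by (intro le_degree) (simp add: coeff_col)
    hence "degree (col 0 q) \<noteq> 0" using \<open>degree q \<noteq> 0\<close> by simp
    then obtain t where "poly (col 0 q) t = 0"
      using fundamental_theorem_of_algebra[of "col 0 q"] by (auto simp: constant_degree)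
    hence "poly (col k q) t = 0" for k using col_q[of k] by (cases "k = 0") simp_all
    hence "poly q [:t:] = 0" by (intro poly_eqI) (simp add: coeff_poly_const col_def)
    thus False using F_nz[of t] by (simp add: q)
  qed
  moreover have "degree F = degree g + degree q"
    using \<open>g \<noteq> 0\<close> \<open>q \<noteq> 0\<close> by (simp add: q degree_mult_eq)
  ultimately show ?thesis using degree_cross_poly[OF ab] by (simp add: F_def)
qed

section \<open>Fields between the constants and C(z)\<close>

locale const_subfield =
  fixes L :: "ratfun set"
  assumes const_in: "const_ratfun c \<in> L"
    and add_in: "f \<in> L \<Longrightarrow> g \<in> L \<Longrightarrow> f + g \<in> L"
    and mult_in: "f \<in> L \<Longrightarrow> g \<in> L \<Longrightarrow> f * g \<in> L"
    and inverse_in: "f \<in> L \<Longrightarrow> inverse f \<in> L"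
begin

lemma zero_in: "0 \<in> L"
  using const_in[of 0] by simp

lemma diff_in: "f \<in> L \<Longrightarrow> g \<in> L \<Longrightarrow> f - g \<in> L"
  using add_in[OF _ mult_in[OF const_in[of "-1"]], of f g] by (simp add: const_ratfun_uminus)

lemma poly_subst_in: "f \<in> L \<Longrightarrow> poly_subst p f \<in> L"
  by (induction p) (auto simp: zero_in intro: add_in const_in mult_in)

definition coeffs_in :: "ratfun poly \<Rightarrow> bool" where
  "coeffs_in p \<longleftrightarrow> (\<forall>i. coeff p i \<in> L)"

text \<open>Division by a monic \<open>m\<close> needs only ring operations on the coefficients. The
  remainder is bounded by vanishing coefficients rather than by its degree, so that
  \<open>degree m = 0\<close> is covered.\<close>

lemma coeffs_in_reduce:
  assumes m: "coeffs_in m" "lead_coeff m = 1" and f: "coeffs_in f" "\<forall>i\<ge>k. coeff f i = 0"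
  shows "\<exists>r. coeffs_in r \<and> (\<forall>i\<ge>degree m. coeff r i = 0) \<and> m dvd f - r"
  using f
proof (induction k arbitrary: f)
  case 0
  thus ?case by (intro exI[of _ f]) auto
next
  case (Suc k)
  show ?case
  proof (cases "k < degree m")
    case True
    thus ?thesis using Suc.prems by (intro exI[of _ f]) auto
  next
    case False
    \<comment> \<open>This multiple of \<open>m\<close> has the same coefficient at \<open>k\<close>
      as \<open>f\<close>.\<close>
    define h where "h = monom (coeff f k) (k - degree m) * m"
    have h: "coeff h i = (if k - degree m \<le> i then coeff f k * coeff m (i - (k - degree m)) else 0)" for i
      by (auto simp: h_def coeff_monom_mult)
    have "coeffs_in (f - h)"
      using Suc.prems(1) m(1) unfolding coeffs_in_def by (auto simp: h intro!: diff_in mult_in zero_in)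
    moreover have "\<forall>i\<ge>k. coeff (f - h) i = 0"
    proof (intro allI impI)
      fix i assume "i \<ge> k"
      show "coeff (f - h) i = 0"
      proof (cases "i = k")
        case True
        thus ?thesis using False m(2) by (simp add: h)
      next
        case False
        thus ?thesis using \<open>i \<ge> k\<close> \<open>\<not> k < degree m\<close> Suc.prems(2)
          by (auto simp: h coeff_eq_0)
      qed
    qed
    ultimately obtain r where r: "coeffs_in r" "\<forall>i\<ge>degree m. coeff r i = 0" "m dvd f - h - r"
      using Suc.IH by blast
    have "m dvd (f - h - r) + h" using r(3) by (intro dvd_add) (simp_all add: h_def)
    thus ?thesis using r by auto
  qed
qed

text \<open>As z generates C(z), this says that C(z) has degree at least \<open>n\<close> over
  \<open>L\<close>.\<close>

definition independent_powers :: "nat \<Rightarrow> bool" where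
  "independent_powers n \<longleftrightarrow>
     (\<forall>c. (\<forall>i<n. c i \<in> L) \<and> (\<Sum>i<n. c i * to_fract [:0, 1:] ^ i) = 0 \<longrightarrow> (\<forall>i<n. c i = 0))"

text \<open>Because \<open>f\<close> is a(z)/b(z), the variable z is a root of a(T) - f b(T); for
  nonconstant \<open>f\<close> it is therefore algebraic over \<open>L\<close>. Clearing the
  denominator makes the coefficients polynomials, in preparation for Gauss' lemma.\<close>

lemma pencil_root:
  assumes "f = to_fract a / to_fract b" "b \<noteq> 0" "f \<in> L"
  defines "h \<equiv> map_poly const_ratfun a - smult f (map_poly const_ratfun b)"
  shows "coeffs_in h" "poly h (to_fract [:0, 1:]) = 0"
    "smult (to_fract b) h = map_poly to_fract (cross_poly a b)"
proof -
  show "coeffs_in h"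
    unfolding coeffs_in_def h_def using assms(3)
    by (auto simp: coeff_map_poly intro!: diff_in mult_in const_in)
  show "poly h (to_fract [:0, 1:]) = 0"
    using assms(1,2) poly_subst_identity by (simp add: h_def poly_subst_def)
  have "map_poly to_fract (map_poly (\<lambda>c. [:c:]) p) = map_poly const_ratfun p" for p :: "complex poly"
    by (intro poly_eqI) (simp add: coeff_map_poly const_ratfun_def)
  thus "smult (to_fract b) h = map_poly to_fract (cross_poly a b)"
    using assms(1,2) by (simp add: h_def cross_poly_def smult_diff_right)
qed

text \<open>The degree over \<open>L\<close> of the variable \<open>z\<close> equals the degree in \<open>z\<close> of a nonconstant coefficient
  of its minimal polynomial, by Gauss' lemma.\<close>
theorem lueroth_generator:
  assumes "u \<in> L" "nonconstant_ratfun u"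
  obtains V where "V \<in> L" "nonconstant_ratfun V" "independent_powers (ratdeg V)"
proof -
  define X where "X = to_fract [:0, 1 :: complex:]"
  define P where "P n \<longleftrightarrow> (\<exists>f. coeffs_in f \<and> poly f X = 0 \<and> f \<noteq> 0 \<and> degree f = n)" for n
  obtain a b where u: "b \<noteq> 0" "u = to_fract a / to_fract b"
    by (rule ratfun_coprime_rep[of u])
  define h where "h = map_poly const_ratfun a - smult u (map_poly const_ratfun b)"
  have h: "coeffs_in h" "poly h X = 0"
    unfolding h_def X_def using pencil_root[OF u(2,1) assms(1)] by auto
  have "h \<noteq> 0"
  proof
    assume "h = 0"
    hence "coeff h (degree b) = 0" by simp
    hence "u * const_ratfun (lead_coeff b) = const_ratfun (coeff a (degree b))"
      by (simp add: h_def coeff_map_poly)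
    hence "u = const_ratfun (coeff a (degree b) / lead_coeff b)"
      using u(1) by (simp add: const_ratfun_divide field_simps)
    thus False using assms(2) by (auto simp: nonconstant_ratfun_def)
  qed
  hence "P (degree h)" using h by (auto simp: P_def)
  define n where "n = (LEAST n. P n)"
  have "P n" unfolding n_def using \<open>P (degree h)\<close> by (rule LeastI)
  have min: "f = 0" if "coeffs_in f" "poly f X = 0" "\<forall>i\<ge>n. coeff f i = 0" for f
  proof (rule ccontr)
    assume "f \<noteq> 0"
    hence "P (degree f)" using that by (auto simp: P_def)
    hence "n \<le> degree f" unfolding n_def by (rule Least_le)
    thus False using that(3) \<open>f \<noteq> 0\<close> by auto
  qed
  have indep: "independent_powers n"
    unfolding independent_powers_def
  proof (intro allI impI, elim conjE)
    fix c i assume c: "\<forall>i<n. c i \<in> L" "(\<Sum>i<n. c i * to_fract [:0, 1:] ^ i) = 0" and "i < n"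
    define f where "f = (\<Sum>i<n. monom (c i) i)"
    have f: "coeff f i = (if i < n then c i else 0)" for i
      by (simp add: f_def coeff_sum coeff_monom)
    have "coeffs_in f" using c(1) by (auto simp: coeffs_in_def f zero_in)
    moreover have "poly f X = 0" using c(2) by (simp add: f_def poly_sum poly_monom X_def)
    ultimately have "f = 0" by (intro min) (simp_all add: f)
    thus "c i = 0" using f[of i] \<open>i < n\<close> by simp
  qed
  obtain f where f: "coeffs_in f" "poly f X = 0" "f \<noteq> 0" "degree f = n"
    using \<open>P n\<close> by (auto simp: P_def)
  \<comment> \<open>The minimal polynomial of z over \<open>L\<close>.\<close>
  define m where "m = smult (inverse (lead_coeff f)) f"
  have m: "coeffs_in m" "poly m X = 0" "lead_coeff m = 1" "degree m = n"
    using f by (auto simp: m_def coeffs_in_def intro: mult_in inverse_in)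
  hence "m \<noteq> 0" by auto
  \<comment> \<open>With constant coefficients only, \<open>m\<close> would make z algebraic over
    the complex numbers.\<close>
  have "\<exists>k. nonconstant_ratfun (coeff m k)"
  proof (rule ccontr)
    assume "\<not> ?thesis"
    then obtain e where e: "coeff m k = const_ratfun (e k)" for k
      by (auto simp: nonconstant_ratfun_def) metis
    define p where "p = (\<Sum>i\<le>n. monom (e i) i)"
    have p: "coeff p i = (if i \<le> n then e i else 0)" for i
      by (simp add: p_def coeff_sum coeff_monom)
    have "to_fract p = poly_subst p X" by (simp add: X_def poly_subst_identity)
    also have "\<dots> = (\<Sum>i\<le>n. const_ratfun (coeff p i) * X ^ i)"
      by (intro poly_subst_altdef degree_le) (simp add: p)
    also have "\<dots> = (\<Sum>i\<le>n. coeff m i * X ^ i)"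
      by (intro sum.cong) (auto simp: p e)
    also have "\<dots> = poly m X" using m(4) by (simp add: poly_altdef)
    finally have "p = 0" using m(2) by simp
    hence "e n = 0" using p[of n] by simp
    thus False using m(3) e[of n] m(4) by simp
  qed
  then obtain k where nc: "nonconstant_ratfun (coeff m k)" ..
  define V where "V = coeff m k"
  have "V \<in> L" using m(1) by (simp add: V_def coeffs_in_def)
  obtain a b where V: "coprime a b" "b \<noteq> 0" "V = to_fract a / to_fract b"
    "ratdeg V = max (degree a) (degree b)" by (rule ratfun_coprime_rep)
  have ab: "degree a \<noteq> 0 \<or> degree b \<noteq> 0"
    using nc V(4) by (auto simp: nonconstant_ratfun_iff_ratdeg simp flip: V_def)
  define w where "w = map_poly const_ratfun a - smult V (map_poly const_ratfun b)"
  have w: "coeffs_in w" "poly w X = 0" "smult (to_fract b) w = map_poly to_fract (cross_poly a b)"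
    unfolding w_def X_def using pencil_root[OF V(3,2) \<open>V \<in> L\<close>] by auto
  have "\<forall>i\<ge>Suc (degree w). coeff w i = 0" by (auto simp: coeff_eq_0)
  then obtain r where r: "coeffs_in r" "\<forall>i\<ge>n. coeff r i = 0" "m dvd w - r"
    using coeffs_in_reduce[OF m(1,3) w(1)] m(4) by blast
  \<comment> \<open>Dividing \<open>w\<close> by \<open>m\<close> leaves a remainder that vanishes
    at z, hence is zero by minimality.\<close>
  have "poly (w - r) X = 0" using r(3) m(2) by (metis dvdE mult_zero_left poly_mult)
  hence "r = 0" using r w(2) by (intro min) auto
  hence "m dvd smult (to_fract b) w" using r(3) by (simp add: dvd_smult)
  hence m_dvd: "m dvd map_poly to_fract (cross_poly a b)" by (simp only: w(3))
  \<comment> \<open>Gauss' lemma: the primitive part has coefficients in C[z] and divides the cross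
    polynomial there.\<close>
  define g where "g = primitive_part_fract m"
  have mg: "m = smult (fract_content m) (map_poly to_fract g)"
    unfolding g_def by (simp add: content_times_primitive_part_fract)
  have "map_poly to_fract g dvd m" by (subst mg) (simp add: dvd_smult)
  hence "map_poly to_fract g dvd map_poly to_fract (cross_poly a b)" using m_dvd by (rule dvd_trans)
  hence g_dvd: "g dvd cross_poly a b"
    by (rule fract_poly_dvdD) (simp add: g_def \<open>m \<noteq> 0\<close>)
  \<comment> \<open>As \<open>m\<close> is monic, \<open>V\<close> is a quotient of two coefficients
    of \<open>g\<close>. In lowest terms it is \<open>a / b\<close>, so these are multiples of
    \<open>a\<close> and \<open>b\<close>, and one of them has degree at least
    \<open>ratdeg V\<close> in z.\<close>
  have "to_fract (coeff g k) = V * to_fract (coeff g n)"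
  proof -
    have "coeff m i = fract_content m * to_fract (coeff g i)" for i
      by (subst mg) (simp add: coeff_map_poly)
    from this[of n] this[of k] show ?thesis
      using m(3,4) by (simp add: V_def mult_ac)
  qed
  hence "to_fract (coeff g k * b) = to_fract (a * coeff g n)"
    using V(2,3) by (simp add: field_simps)
  hence eq: "coeff g k * b = a * coeff g n" by (simp only: to_fract_eq_iff)
  hence "b dvd coeff g n"
    using V(1) by (metis coprime_commute coprime_dvd_mult_right_iff dvd_triv_right)
  then obtain e where e: "coeff g n = b * e" ..
  hence e': "coeff g k = a * e" using eq V(2) by simp
  have "degree g = n" using m(4) by (simp add: g_def)
  hence "coeff g n \<noteq> 0" using \<open>m \<noteq> 0\<close> mg by (metis leading_coeff_0_iff map_poly_0 smult_0_right)
  hence "e \<noteq> 0" using e by auto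
  have "\<exists>i. max (degree a) (degree b) \<le> degree (coeff g i)"
  proof (cases "degree b \<le> degree a")
    case True
    hence "a \<noteq> 0" using ab by auto
    thus ?thesis using True \<open>e \<noteq> 0\<close> by (intro exI[of _ k]) (simp add: e' degree_mult_eq)
  next
    case False
    thus ?thesis using \<open>e \<noteq> 0\<close> V(2) by (intro exI[of _ n]) (simp add: e degree_mult_eq)
  qed
  then obtain i where i: "max (degree a) (degree b) \<le> degree (coeff g i)" ..
  have "ratdeg V = n"
    using degree_divisor_cross_poly[OF V(1) ab g_dvd i] V(4) \<open>degree g = n\<close> by simp
  thus thesis using that[of V] \<open>V \<in> L\<close> nc indep by (simp add: V_def)
qed

text \<open>If \<open>u\<close> were not in \<open>C(V)\<close>, the products \<open>z\<^sup>i V\<^sup>j\<close> and \<open>u z\<^sup>i V\<^sup>j\<close> would be linearly independent; over a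
  common denominator they are too many polynomials of too small degree.\<close>
theorem generator_of_independent_powers:
  assumes V: "V \<in> L" "nonconstant_ratfun V" "independent_powers (ratdeg V)" and "u \<in> L"
  obtains A B where "coprime A B" "B \<noteq> 0" "u = poly_subst A V / poly_subst B V"
proof -
  define X where "X = to_fract [:0, 1 :: complex:]"
  define n where "n = ratdeg V"
  have "n > 0" using V(2) by (simp add: n_def nonconstant_ratfun_iff_ratdeg)
  obtain a b where ab: "b \<noteq> 0" "V = to_fract a / to_fract b" "n = max (degree a) (degree b)"
    unfolding n_def by (rule ratfun_coprime_rep[of V])
  obtain p q where pq: "q \<noteq> 0" "u = to_fract p / to_fract q" "ratdeg u = max (degree p) (degree q)"
    by (rule ratfun_coprime_rep[of u])
  \<comment> \<open>Powers of \<open>V\<close> up to \<open>e\<close> suffice: they give 2n(e + 1)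
    polynomials of degree below n + en + e, a smaller number.\<close>
  define e where "e = ratdeg u"
  define I where "I = {..<n} \<times> {..e} \<times> (UNIV :: bool set)"
  \<comment> \<open>The products z^i V^j, with or without the factor \<open>u\<close>, times the
    common denominator b^e q.\<close>
  define f where "f = (\<lambda>(i, j, s). monom 1 i * (a ^ j * b ^ (e - j) * (if s then p else q)))"
  have fin: "finite I" by (simp add: I_def)
  have "card I = n * (Suc e * 2)" by (simp add: I_def card_cartesian_product)
  hence card: "n + e * n + e < card I" using \<open>n > 0\<close> by (cases n) (simp_all add: algebra_simps)
  have f0: "coeff (f x) k = 0" if x: "x \<in> I" and "k \<ge> n + e * n + e" for x k
  proof -
    obtain i j s where ijs: "x = (i, j, s)" "i < n" "j \<le> e" using x by (auto simp: I_def)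
    have "degree (monom 1 i :: complex poly) = i" by (simp add: degree_monom_eq)
    moreover have "degree (a ^ j) \<le> j * n" "degree (b ^ (e - j)) \<le> (e - j) * n"
      using ab(3) by (auto intro!: coeff_power_top)
    moreover have "j * n + (e - j) * n = e * n" using ijs by (simp flip: add_mult_distrib)
    moreover have "degree (if s then p else q) \<le> e" using pq(3) by (auto simp: e_def)
    ultimately have "degree (f x) \<le> i + (e * n + e)"
      unfolding ijs f_def prod.case
      by (intro order_trans[OF degree_mult_le] add_mono) (auto intro: order_trans[OF degree_mult_le] add_mono)
    thus ?thesis using that ijs by (intro coeff_eq_0) linarith
  qed
  obtain x where x: "\<exists>t\<in>I. x t \<noteq> 0" "(\<Sum>t\<in>I. smult (x t) (f t)) = 0"
    using poly_family_linearly_dependent[OF fin card, of f] f0 by blast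
  define A where "A s i = (\<Sum>j\<le>e. monom (x (i, j, s)) j)" for s i
  have coeff_A: "coeff (A s i) j = (if j \<le> e then x (i, j, s) else 0)" for s i j
    by (simp add: A_def coeff_sum coeff_monom)
  have subst_A: "poly_subst (A s i) V = (\<Sum>j\<le>e. const_ratfun (x (i, j, s)) * V ^ j)" for s i
  proof -
    have "poly_subst (A s i) V = (\<Sum>j\<le>e. const_ratfun (coeff (A s i) j) * V ^ j)"
      by (intro poly_subst_altdef degree_le) (simp add: coeff_A)
    thus ?thesis by (simp add: coeff_A)
  qed
  \<comment> \<open>The dependence is grouped by powers of z; its coefficients lie in
    \<open>L\<close>, so they vanish by independence.\<close>
  define c where "c i = poly_subst (A True i) V * u + poly_subst (A False i) V" for i
  define D where "D = to_fract b ^ e * to_fract q"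
  have "D \<noteq> 0" using ab(1) pq(1) by (simp add: D_def)
  have summand: "to_fract (smult (x (i, j, s)) (f (i, j, s))) =
      D * (const_ratfun (x (i, j, s)) * V ^ j * (if s then u else 1) * X ^ i)" if "j \<le> e" for i j s
  proof -
    have "monom 1 i = [:0, 1 :: complex:] ^ i" by (simp add: monom_altdef)
    hence X: "to_fract (monom 1 i) = X ^ i" by (simp only: to_fract_power X_def)
    have "to_fract a ^ j * to_fract b ^ (e - j) = to_fract b ^ e * V ^ j"
      using that ab(1) by (simp add: ab(2) power_divide power_diff)
    moreover have "to_fract (if s then p else q) = to_fract q * (if s then u else 1)"
      using pq(1,2) by simp
    ultimately show ?thesis
      by (simp only: f_def prod.case to_fract_smult to_fract_mult to_fract_power X D_def mult_ac)
  qed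
  have "0 = to_fract (\<Sum>t\<in>I. smult (x t) (f t))" by (simp add: x(2))
  also have "\<dots> = (\<Sum>i<n. \<Sum>j\<le>e. \<Sum>s\<in>UNIV. to_fract (smult (x (i, j, s)) (f (i, j, s))))"
    unfolding I_def to_fract_sum by (simp only: sum.cartesian_product case_prod_beta' prod.collapse)
  also have "\<dots> = (\<Sum>i<n. D * (c i * X ^ i))"
  proof (intro sum.cong refl)
    fix i
    have "(\<Sum>j\<le>e. \<Sum>s\<in>UNIV. to_fract (smult (x (i, j, s)) (f (i, j, s)))) =
      (\<Sum>j\<le>e. D * (const_ratfun (x (i, j, True)) * V ^ j * u * X ^ i)
             + D * (const_ratfun (x (i, j, False)) * V ^ j * X ^ i))"
      by (intro sum.cong refl) (simp add: UNIV_bool summand)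
    also have "\<dots> = D * (c i * X ^ i)"
      by (simp add: c_def subst_A sum.distrib sum_distrib_left sum_distrib_right algebra_simps)
    finally show "(\<Sum>j\<le>e. \<Sum>s\<in>UNIV. to_fract (smult (x (i, j, s)) (f (i, j, s)))) = D * (c i * X ^ i)" .
  qed
  finally have "(\<Sum>i<n. c i * X ^ i) = 0"
    using \<open>D \<noteq> 0\<close> by (simp flip: sum_distrib_left)
  moreover have "c i \<in> L" for i
    unfolding c_def using V(1) assms(4) by (intro add_in mult_in poly_subst_in)
  ultimately have c0: "c i = 0" if "i < n" for i
    using V(3) that unfolding independent_powers_def by (auto simp: n_def X_def)
  obtain i j s where ijs: "i < n" "j \<le> e" "x (i, j, s) \<noteq> 0" using x(1) by (auto simp: I_def)
  \<comment> \<open>Otherwise \<open>A False i\<close> would vanish too, \<open>V\<close> being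
    transcendental, against the choice of \<open>i\<close>. Hence \<open>c i = 0\<close> can be
    solved for \<open>u\<close>.\<close>
  have "A True i \<noteq> 0"
  proof
    assume "A True i = 0"
    hence "A False i = 0" using c0[OF ijs(1)] V(2) by (simp add: c_def poly_subst_eq_0_iff)
    hence "A s i = 0" using \<open>A True i = 0\<close> by (cases s) auto
    thus False using coeff_A[of s i j] ijs by simp
  qed
  moreover have "poly_subst (A True i) V * u = poly_subst (- A False i) V"
    using c0[OF ijs(1)] poly_subst_add[of "- A False i" "A False i" V]
    by (metis add.left_inverse add_right_cancel c_def poly_subst_0)
  ultimately show thesis
    using V(2) by (intro that[OF coprime_quot_of_fract snd_quot_of_fract_nonzero
      poly_subst_quot_of_fract[of V _ u]])
qed

end

subsection \<open>Values along a filter of points\<close>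

text \<open>At a pole the value is 0 by convention; identities between values are stated along
  filters that ignore the finitely many poles.\<close>

definition ratfun_value :: "ratfun \<Rightarrow> complex \<Rightarrow> complex" where
  "ratfun_value f s = poly (fst (quot_of_fract f)) s / poly (snd (quot_of_fract f)) s"

text \<open>Abstracts from the cofinite subsets of an infinite set: finitely many points can be
  discarded, yet some point always remains.\<close>

locale point_filter =
  fixes F :: "complex filter"
  assumes not_bot: "F \<noteq> bot" and le_cofinite: "F \<le> cofinite"
begin

lemma eventually_poly_nonzero:
  assumes "p \<noteq> 0"
  shows "\<forall>\<^sub>F s in F. poly p s \<noteq> 0"
proof -
  have "eventually (\<lambda>s. poly p s \<noteq> 0) cofinite"
    using poly_roots_finite[OF assms] by (simp add: eventually_cofinite)
  thus ?thesis by (rule filter_leD[OF le_cofinite])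
qed

lemma eventually_value:
  assumes "b \<noteq> 0" "f = to_fract a / to_fract b"
  shows "\<forall>\<^sub>F s in F. ratfun_value f s = poly a s / poly b s \<and> poly b s \<noteq> 0"
proof -
  define c d where "c = fst (quot_of_fract f)" and "d = snd (quot_of_fract f)"
  have d: "d \<noteq> 0" by (simp add: d_def)
  have "f = to_fract c / to_fract d"
    unfolding c_def d_def by (rule quot_of_fract_divide_to_fract)
  hence "to_fract (a * d) = to_fract (c * b)" using assms d by (simp add: field_simps)
  hence "a * d = c * b" by (simp only: to_fract_eq_iff)
  hence eq: "poly a s * poly d s = poly c s * poly b s" for s by (metis poly_mult)
  show ?thesis
    using eventually_poly_nonzero[OF assms(1)] eventually_poly_nonzero[OF d]
  proof eventually_elim
    case (elim s)
    thus ?case using eq[of s] by (simp add: ratfun_value_def field_simps flip: c_def d_def)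
  qed
qed

lemma eventually_value_binop:
  assumes "f = to_fract a / to_fract b" "g = to_fract c / to_fract d" "b \<noteq> 0" "d \<noteq> 0"
  shows "\<forall>\<^sub>F s in F. ratfun_value (f + g) s = ratfun_value f s + ratfun_value g s"
    "\<forall>\<^sub>F s in F. ratfun_value (f * g) s = ratfun_value f s * ratfun_value g s"
proof -
  have bd: "b * d \<noteq> 0" using assms by simp
  have "f + g = to_fract (a * d + c * b) / to_fract (b * d)"
    unfolding assms(1,2) using assms(3,4) by (simp add: field_simps)
  from eventually_value[OF bd this] eventually_value[OF assms(3,1)] eventually_value[OF assms(4,2)]
  show "\<forall>\<^sub>F s in F. ratfun_value (f + g) s = ratfun_value f s + ratfun_value g s"
    by eventually_elim (simp add: add_frac_eq)
  have "f * g = to_fract (a * c) / to_fract (b * d)" unfolding assms(1,2) by simp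
  from eventually_value[OF bd this] eventually_value[OF assms(3,1)] eventually_value[OF assms(4,2)]
  show "\<forall>\<^sub>F s in F. ratfun_value (f * g) s = ratfun_value f s * ratfun_value g s"
    by eventually_elim simp
qed

lemma eventually_value_add: "\<forall>\<^sub>F s in F. ratfun_value (f + g) s = ratfun_value f s + ratfun_value g s"
  and eventually_value_mult: "\<forall>\<^sub>F s in F. ratfun_value (f * g) s = ratfun_value f s * ratfun_value g s"
proof -
  obtain a b where 1: "b \<noteq> 0" "f = to_fract a / to_fract b" by (rule ratfun_coprime_rep)
  obtain c d where 2: "d \<noteq> 0" "g = to_fract c / to_fract d" by (rule ratfun_coprime_rep)
  show "\<forall>\<^sub>F s in F. ratfun_value (f + g) s = ratfun_value f s + ratfun_value g s"
    "\<forall>\<^sub>F s in F. ratfun_value (f * g) s = ratfun_value f s * ratfun_value g s"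
    using eventually_value_binop[OF 1(2) 2(2) 1(1) 2(1)] by auto
qed

lemma ratfun_value_const [simp]: "ratfun_value (const_ratfun c) s = c"
  by (simp add: ratfun_value_def const_ratfun_def)

lemma ratfun_value_0 [simp]: "ratfun_value 0 s = 0"
  using ratfun_value_const[of 0 s] by simp

lemma eventually_value_nonzero:
  assumes "f \<noteq> 0"
  shows "\<forall>\<^sub>F s in F. ratfun_value f s \<noteq> 0"
proof -
  obtain a b where ab: "b \<noteq> 0" "f = to_fract a / to_fract b" by (rule ratfun_coprime_rep)
  hence "a \<noteq> 0" using assms by auto
  show ?thesis
    using eventually_value[OF ab] eventually_poly_nonzero[OF \<open>a \<noteq> 0\<close>]
    by eventually_elim simp
qed

lemma eventually_value_uminus: "\<forall>\<^sub>F s in F. ratfun_value (- f) s = - ratfun_value f s"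
proof -
  have "- f = const_ratfun (-1) * f" by (simp add: const_ratfun_uminus)
  thus ?thesis using eventually_value_mult[of "const_ratfun (-1)" f] by simp
qed

lemma eventually_value_diff: "\<forall>\<^sub>F s in F. ratfun_value (f - g) s = ratfun_value f s - ratfun_value g s"
  using eventually_value_add[of f "- g"] eventually_value_uminus[of g]
  by eventually_elim simp

lemma eventually_value_inverse: "\<forall>\<^sub>F s in F. ratfun_value (inverse f) s = inverse (ratfun_value f s)"
proof (cases "f = 0")
  case False
  show ?thesis
    using eventually_value_mult[of "inverse f" f] eventually_value_nonzero[OF False]
  proof eventually_elim
    case (elim s)
    have "inverse f * f = const_ratfun 1" using False by simp
    hence "ratfun_value (inverse f) s * ratfun_value f s = 1"
      using elim(1) by (metis ratfun_value_const)
    thus ?case using elim(2) by (simp add: field_simps)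
  qed
qed simp

lemma eventually_value_divide: "\<forall>\<^sub>F s in F. ratfun_value (f / g) s = ratfun_value f s / ratfun_value g s"
  unfolding divide_inverse
  using eventually_value_mult[of f "inverse g"] eventually_value_inverse[of g]
  by eventually_elim simp

lemma eventually_value_poly_subst: "\<forall>\<^sub>F s in F. ratfun_value (poly_subst p f) s = poly p (ratfun_value f s)"
proof (induction p)
  case 0
  show ?case by simp
next
  case (pCons a p)
  show ?case
    using eventually_value_add[of "const_ratfun a" "f * poly_subst p f"]
      eventually_value_mult[of f "poly_subst p f"] pCons.IH
    by eventually_elim simp
qed

text \<open>A nonzero difference has only finitely many zeros, so it cannot vanish along
  \<open>F\<close>.\<close>

lemma ratfun_eqI:
  assumes "\<forall>\<^sub>F s in F. ratfun_value f s = ratfun_value g s"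
  shows "f = g"
proof (rule ccontr)
  assume "f \<noteq> g"
  hence "\<forall>\<^sub>F s in F. ratfun_value (f - g) s \<noteq> 0" by (intro eventually_value_nonzero) simp
  hence "\<forall>\<^sub>F s in F. False"
    using assms eventually_value_diff[of f g] by eventually_elim simp
  thus False using not_bot by (simp add: eventually_False)
qed

text \<open>In particular \<open>conjugates f f\<close> expresses that \<open>f\<close> is real
  along \<open>F\<close>. For a given \<open>f\<close> there may be no such
  \<open>g\<close>.\<close>

definition conjugates :: "ratfun \<Rightarrow> ratfun \<Rightarrow> bool" where
  "conjugates f g \<longleftrightarrow> (\<forall>\<^sub>F s in F. ratfun_value g s = cnj (ratfun_value f s))"

lemma conjugates_sym: "conjugates f g \<Longrightarrow> conjugates g f"
  unfolding conjugates_def by (erule eventually_mono) simp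

lemma conjugates_unique:
  assumes "conjugates f g" "conjugates f h"
  shows "g = h"
proof (rule ratfun_eqI)
  show "\<forall>\<^sub>F s in F. ratfun_value g s = ratfun_value h s"
    using assms unfolding conjugates_def by eventually_elim simp
qed

lemma conjugates_const: "conjugates (const_ratfun c) (const_ratfun (cnj c))"
  by (simp add: conjugates_def)

lemma conjugates_add:
  assumes "conjugates f g" "conjugates f' g'"
  shows "conjugates (f + f') (g + g')"
  using assms eventually_value_add[of f f'] eventually_value_add[of g g']
  unfolding conjugates_def by eventually_elim simp

lemma conjugates_mult:
  assumes "conjugates f g" "conjugates f' g'"
  shows "conjugates (f * f') (g * g')"
  using assms eventually_value_mult[of f f'] eventually_value_mult[of g g']
  unfolding conjugates_def by eventually_elim simp

lemma conjugates_inverse: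
  assumes "conjugates f g"
  shows "conjugates (inverse f) (inverse g)"
  using assms eventually_value_inverse[of f] eventually_value_inverse[of g]
  unfolding conjugates_def by eventually_elim simp

lemma conjugates_divide: "conjugates f g \<Longrightarrow> conjugates f' g' \<Longrightarrow> conjugates (f / f') (g / g')"
  unfolding divide_inverse by (intro conjugates_mult conjugates_inverse)

lemma conjugates_poly_subst:
  "conjugates f g \<Longrightarrow> conjugates (poly_subst p f) (poly_subst (map_poly cnj p) g)"
proof (induction p)
  case 0
  show ?case using conjugates_const[of 0] by simp
next
  case (pCons a p)
  thus ?case by (simp add: map_poly_pCons conjugates_add conjugates_mult conjugates_const)
qed

sublocale const_subfield "{f. \<exists>g. conjugates f g}"
proof
  show "const_ratfun c \<in> {f. \<exists>g. conjugates f g}" for c using conjugates_const by blast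
next
  fix f assume "f \<in> {f. \<exists>g. conjugates f g}"
  thus "inverse f \<in> {f. \<exists>g. conjugates f g}" using conjugates_inverse by blast
next
  fix f g assume *: "f \<in> {f. \<exists>g. conjugates f g}" "g \<in> {f. \<exists>g. conjugates f g}"
  thus "f + g \<in> {f. \<exists>g. conjugates f g}" using conjugates_add by blast
  from * show "f * g \<in> {f. \<exists>g. conjugates f g}" using conjugates_mult by blast
qed

section \<open>Generators that are real along the filter\<close>

lemma coprime_map_poly_cnj: "coprime (map_poly cnj p) (map_poly cnj q) \<longleftrightarrow> coprime p q"
proof -
  have "(\<forall>x. poly p (cnj x) \<noteq> 0 \<or> poly q (cnj x) \<noteq> 0) \<longleftrightarrow> (\<forall>x. poly p x \<noteq> 0 \<or> poly q x \<noteq> 0)"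
    using complex_cnj_cnj by (intro iffI allI) (erule allE[of _ "cnj _"], simp)+
  thus ?thesis by (simp add: coprime_poly_complex_iff)
qed

text \<open>Each difference of values of \<open>m\<close> is the difference of the arguments times
  the determinant over two denominators. Every point occurs once above and once below, so these
  factors cancel; a zero denominator occurs on both sides at once, where both quotients are
  0.\<close>

lemma cross_ratio_moebius:
  fixes a b c d w x y z :: complex
  defines "m \<equiv> \<lambda>t. (a * t + b) / (c * t + d)"
  assumes "a * d - b * c \<noteq> 0"
    and "c * w + d \<noteq> 0" "c * x + d \<noteq> 0" "c * y + d \<noteq> 0" "c * z + d \<noteq> 0"
  shows "(m w - m x) * (m y - m z) / ((m w - m z) * (m y - m x)) =
         (w - x) * (y - z) / ((w - z) * (y - x))"
proof -
  have diff: "m s - m t = (a * d - b * c) * (s - t) / ((c * s + d) * (c * t + d))"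
    if "c * s + d \<noteq> 0" "c * t + d \<noteq> 0" for s t
    using that by (simp add: m_def diff_frac_eq) (simp add: algebra_simps)
  define e where "e = (a * d - b * c) ^ 2 / ((c * w + d) * (c * x + d) * (c * y + d) * (c * z + d))"
  have "(m w - m x) * (m y - m z) = e * ((w - x) * (y - z))"
    "(m w - m z) * (m y - m x) = e * ((w - z) * (y - x))"
    using assms(3-) by (simp_all add: diff e_def power2_eq_square mult_ac)
  moreover have "e \<noteq> 0" using assms(2-) by (simp add: e_def)
  ultimately show ?thesis by simp
qed

text \<open>Here \<open>k\<close> is the degree of the conjugate \<open>V'\<close> as a function of \<open>V\<close>; by symmetry also of \<open>V\<close> as a
  function of \<open>V'\<close>, so \<open>k\<^sup>2 = 1\<close>. The generator \<open>W\<close> is the cross ratio of \<open>V\<close> with three of its values.\<close>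
lemma real_generator:
  assumes "\<exists>g. conjugates u g" "nonconstant_ratfun u"
  obtains W where "conjugates W W" "nonconstant_ratfun W" "independent_powers (ratdeg W)"
proof -
  have "u \<in> {f. \<exists>g. conjugates f g}" using assms(1) by simp
  then obtain V where V: "V \<in> {f. \<exists>g. conjugates f g}" "nonconstant_ratfun V"
      "independent_powers (ratdeg V)"
    using assms(2) by (rule lueroth_generator)
  then obtain V' where V': "conjugates V V'" by blast
  have "V' \<in> {f. \<exists>g. conjugates f g}" using conjugates_sym[OF V'] by blast
  with V obtain A B where AB: "coprime A B" "B \<noteq> 0" "V' = poly_subst A V / poly_subst B V"
    by (rule generator_of_independent_powers)
  define k where "k = max (degree A) (degree B)"
  have deg: "ratdeg V' = k * ratdeg V"
    unfolding AB(3) k_def by (rule ratdeg_compose[OF AB(1,2) V(2)])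
  have V'_nc: "nonconstant_ratfun V'"
    unfolding nonconstant_ratfun_def
  proof (intro allI notI)
    fix c assume "V' = const_ratfun c"
    hence "V = const_ratfun (cnj c)"
      using conjugates_unique[OF _ conjugates_sym[OF V']] conjugates_const[of c] by metis
    thus False using V(2) by (simp add: nonconstant_ratfun_def)
  qed
  \<comment> \<open>Conjugating the formula for \<open>V'\<close> expresses \<open>V\<close> through
    \<open>V'\<close> with conjugated coefficients, which keeps coprimality and degrees.\<close>
  have "conjugates V' (poly_subst (map_poly cnj A) V' / poly_subst (map_poly cnj B) V')"
    by (subst AB(3)) (intro conjugates_divide conjugates_poly_subst V')
  hence "V = poly_subst (map_poly cnj A) V' / poly_subst (map_poly cnj B) V'"
    by (rule conjugates_unique[OF conjugates_sym[OF V']])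
  hence "ratdeg V = k * ratdeg V'"
    using ratdeg_compose[OF _ _ V'_nc, of "map_poly cnj A" "map_poly cnj B"] AB(1,2)
    by (simp add: coprime_map_poly_cnj map_poly_eq_0_iff degree_map_poly k_def)
  hence "ratdeg V * 1 = ratdeg V * (k * k)" by (simp add: deg mult_ac)
  hence "k = 1" using V(2) by (simp add: nonconstant_ratfun_iff_ratdeg)
  have linear: "poly p t = coeff p 1 * t + coeff p 0" if "degree p \<le> k" for p and t :: complex
    using poly_eq_sum_upto[OF that] \<open>k = 1\<close> by simp
  define a b c d where abcd: "a = coeff A 1" "b = coeff A 0" "c = coeff B 1" "d = coeff B 0"
  have AB_linear: "poly A t = a * t + b" "poly B t = c * t + d" for t
    unfolding abcd by (simp_all only: linear k_def max.cobounded1 max.cobounded2)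
  define w where "w = ratfun_value V"
  define m where "m t = (a * t + b) / (c * t + d)" for t
  \<comment> \<open>Points at which conjugation of the value of \<open>V\<close> is the fractional
    linear map \<open>m\<close>.\<close>
  define good where "good s \<longleftrightarrow> c * w s + d \<noteq> 0 \<and> cnj (w s) = m (w s)" for s
  have "poly_subst B V \<noteq> 0" using AB(2) V(2) by (simp add: poly_subst_eq_0_iff)
  have good: "\<forall>\<^sub>F s in F. good s"
    unfolding good_def using V'[unfolded conjugates_def AB(3)] eventually_value_nonzero[OF \<open>poly_subst B V \<noteq> 0\<close>]
      eventually_value_poly_subst[of B V] eventually_value_poly_subst[of A V]
      eventually_value_divide[of "poly_subst A V" "poly_subst B V"]
    by eventually_elim (simp add: w_def m_def flip: AB_linear)
  have avoid: "\<forall>\<^sub>F s in F. w s \<noteq> t" for t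
  proof -
    have "V - const_ratfun t \<noteq> 0" using V(2) by (simp add: nonconstant_ratfun_def)
    from eventually_value_nonzero[OF this] eventually_value_diff[of V "const_ratfun t"]
    show ?thesis by eventually_elim (simp add: w_def)
  qed
  obtain s0 where s0: "good s0"
    using eventually_happens'[OF not_bot good] by blast
  obtain s1 where s1: "good s1" "w s1 \<noteq> w s0"
    using eventually_happens'[OF not_bot eventually_conj[OF good avoid[of "w s0"]]] by auto
  obtain s2 where s2: "good s2" "w s2 \<noteq> w s0" "w s2 \<noteq> w s1"
    using eventually_happens'[OF not_bot
      eventually_conj[OF good eventually_conj[OF avoid[of "w s0"] avoid[of "w s1"]]]] by auto
  \<comment> \<open>A degenerate \<open>m\<close> would take the same value at two good points with
    different \<open>w\<close>, but conjugation is injective.\<close>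
  have det: "a * d - b * c \<noteq> 0"
  proof
    assume det: "a * d - b * c = 0"
    have "(a * w s1 + b) * (c * w s0 + d) - (a * w s0 + b) * (c * w s1 + d) =
        (a * d - b * c) * (w s1 - w s0)" by (simp add: algebra_simps)
    hence "m (w s1) = m (w s0)"
      using s0 s1(1) det by (simp add: good_def m_def frac_eq_eq)
    hence "cnj (w s1) = cnj (w s0)" using s0 s1(1) by (simp only: good_def)
    thus False using s1(2) by simp
  qed
  \<comment> \<open>The quotient of \<open>P\<close> and \<open>Q\<close> sends \<open>w s0\<close>,
    \<open>w s1\<close>, \<open>w s2\<close> to 0, 1 and infinity.\<close>
  define P where "P = smult (w s1 - w s2) [:- w s0, 1:]"
  define Q where "Q = smult (w s1 - w s0) [:- w s2, 1:]"
  define W where "W = poly_subst P V / poly_subst Q V"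
  have Q: "Q \<noteq> 0" using s1 by (simp add: Q_def)
  have "coprime P Q"
    using s1 s2 by (auto simp: coprime_poly_complex_iff P_def Q_def)
  \<comment> \<open>Equal degrees carry \<open>independent_powers\<close> over from \<open>V\<close>
    to \<open>W\<close>.\<close>
  hence "ratdeg W = ratdeg V"
    using ratdeg_compose[OF _ Q V(2), of P] s1 s2 by (simp add: W_def P_def Q_def)
  moreover have "conjugates W W"
    unfolding conjugates_def W_def
    using good eventually_value_divide[of "poly_subst P V" "poly_subst Q V"]
      eventually_value_poly_subst[of P V] eventually_value_poly_subst[of Q V]
  proof eventually_elim
    case (elim s)
    have value_eq: "ratfun_value (poly_subst P V / poly_subst Q V) s =
        (w s - w s0) * (w s1 - w s2) / ((w s - w s2) * (w s1 - w s0))"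
    proof -
      have "poly P (w s) = (w s - w s0) * (w s1 - w s2)" "poly Q (w s) = (w s - w s2) * (w s1 - w s0)"
        by (simp_all add: P_def Q_def algebra_simps)
      thus ?thesis using elim(2-4) by (simp only: flip: w_def)
    qed
    \<comment> \<open>At good points conjugation acts as \<open>m\<close>, which preserves cross
      ratios; so the value of \<open>W\<close> is real.\<close>
    have "cnj ((w s - w s0) * (w s1 - w s2) / ((w s - w s2) * (w s1 - w s0))) =
        (m (w s) - m (w s0)) * (m (w s1) - m (w s2)) / ((m (w s) - m (w s2)) * (m (w s1) - m (w s0)))"
      using elim(1) s0 s1(1) s2(1)
      by (simp only: good_def complex_cnj_divide complex_cnj_mult complex_cnj_diff)
    also have "\<dots> = (w s - w s0) * (w s1 - w s2) / ((w s - w s2) * (w s1 - w s0))"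
      unfolding m_def using elim(1) s0 s1(1) s2(1)
      by (intro cross_ratio_moebius det) (simp_all only: good_def not_False_eq_True)
    finally show ?case unfolding value_eq by simp
  qed
  ultimately show thesis
    using that[of W] V(2,3) by (simp add: nonconstant_ratfun_iff_ratdeg)
qed

lemma ratfun_comp_Fract:
  assumes "nonconstant_ratfun W" "B \<noteq> 0" "poly_subst B W * f = poly_subst A W"
  shows "f = ratfun_comp (Fract A B) W"
  using poly_subst_quot_of_fract[OF assms] by (simp add: ratfun_comp_def case_prod_beta)

text \<open>Conjugation gives a second representation of \<open>f\<close>, with conjugated
  coefficients. A combination of the two represents \<open>f\<close> again if its denominator is
  nonzero, and suitable combinations are real.\<close>

lemma real_ratfun_of_generator:
  assumes W: "conjugates W W" "nonconstant_ratfun W" "independent_powers (ratdeg W)"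
    and f: "conjugates f f"
  shows "\<exists>P. real_ratfun P \<and> f = ratfun_comp P W"
proof -
  obtain A B where AB: "B \<noteq> 0" "f = poly_subst A W / poly_subst B W"
  proof -
    have "W \<in> {f. \<exists>g. conjugates f g}" "f \<in> {f. \<exists>g. conjugates f g}" using W(1) f by auto
    thus thesis using generator_of_independent_powers[OF _ W(2,3)] that by blast
  qed
  have "conjugates f (poly_subst (map_poly cnj A) W / poly_subst (map_poly cnj B) W)"
    by (subst AB(2)) (intro conjugates_divide conjugates_poly_subst W)
  hence f': "f = poly_subst (map_poly cnj A) W / poly_subst (map_poly cnj B) W"
    by (rule conjugates_unique[OF f])
  have "map_poly cnj B \<noteq> 0" using AB(1) by (simp add: map_poly_eq_0_iff)
  hence eq: "poly_subst B W * f = poly_subst A W"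
    "poly_subst (map_poly cnj B) W * f = poly_subst (map_poly cnj A) W"
    by (simp add: AB W(2) poly_subst_eq_0_iff, subst f', simp add: W(2) poly_subst_eq_0_iff)
  \<comment> \<open>For \<open>t = 1\<close> this is twice the real part of the coefficients, for
    \<open>t\<close> the imaginary unit minus twice the imaginary part; they cannot both vanish for
    a nonzero \<open>B\<close>.\<close>
  define part where "part t p = smult t p + smult (cnj t) (map_poly cnj p)" for t p
  have part_eq: "poly_subst (part t B) W * f = poly_subst (part t A) W" for t
    by (simp add: part_def poly_subst_add poly_subst_smult distrib_right mult.assoc eq)
  have real: "real_poly (part t p)" for t p
    by (simp add: part_def real_poly_def coeff_map_poly complex_is_Real_iff)
  have "part 1 B \<noteq> 0 \<or> part \<i> B \<noteq> 0"
  proof (rule ccontr)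
    assume "\<not> ?thesis"
    hence "coeff (part 1 B) n = 0" "coeff (part \<i> B) n = 0" for n by simp_all
    hence "coeff B n = 0" for n
      by (simp add: part_def coeff_map_poly complex_eq_iff)
    thus False using AB(1) by (simp add: poly_eq_iff)
  qed
  then obtain t where "part t B \<noteq> 0" by blast
  moreover from this have "real_ratfun (Fract (part t A) (part t B))"
    unfolding real_ratfun_def using real by blast
  ultimately show ?thesis using ratfun_comp_Fract[OF W(2) _ part_eq] by blast
qed

end

section \<open>From the common preimage to a filter\<close>

theorem theorem2:
  fixes \<beta>1 \<beta>2 :: ratfun and K1 K2 :: "real set"
  assumes "nonconstant_ratfun \<beta>1" and "nonconstant_ratfun \<beta>2"
    and "infinite (ratfun_preimage \<beta>1 K1 \<inter> ratfun_preimage \<beta>2 K2)"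
  shows "\<exists>W P1 P2. real_ratfun P1 \<and> real_ratfun P2 \<and>
           \<beta>1 = ratfun_comp P1 W \<and> \<beta>2 = ratfun_comp P2 W"
proof -
  \<comment> \<open>Infinity is a single point of the sphere, so infinitely many points remain in
    the plane.\<close>
  define S where "S = {s. Some s \<in> ratfun_preimage \<beta>1 K1 \<inter> ratfun_preimage \<beta>2 K2}"
  have "ratfun_preimage \<beta>1 K1 \<inter> ratfun_preimage \<beta>2 K2 \<subseteq> insert None (Some ` S)"
    by (auto simp: S_def image_iff) (metis not_None_eq)
  hence "infinite S" using assms(3) by (meson finite_imageI finite_insert finite_subset)
  \<comment> \<open>Properties along \<open>F\<close> are those that hold on \<open>S\<close> with
    finitely many exceptions.\<close>
  define F where "F = inf cofinite (principal S)"
  have eventually_F: "eventually P F \<longleftrightarrow> finite {s \<in> S. \<not> P s}" for P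
    by (simp add: F_def eventually_inf_principal eventually_cofinite conj_commute)
  interpret point_filter F
  proof
    show "F \<noteq> bot" using \<open>infinite S\<close> eventually_F[of "\<lambda>_. False"] by (auto simp: trivial_limit_def)
    show "F \<le> cofinite" by (simp add: F_def)
  qed
  \<comment> \<open>\<open>ratfun_eval\<close> sends poles to \<open>None\<close>, so at points of
    the preimage the denominator is nonzero and both notions of value agree.\<close>
  have value_eq: "ratfun_value f s = cnj (ratfun_value f s)" if "Some s \<in> ratfun_preimage f K" for f K s
  proof -
    from that obtain x where "ratfun_value f s = complex_of_real x"
      by (auto simp: ratfun_preimage_def ratfun_eval_def ratfun_value_def case_prod_beta
        split: if_splits)
    thus ?thesis by simp
  qed
  have real: "conjugates \<beta>1 \<beta>1" "conjugates \<beta>2 \<beta>2"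
    using value_eq by (auto simp: conjugates_def eventually_F S_def intro: finite_subset[OF _ finite.emptyI])
  obtain W where W: "conjugates W W" "nonconstant_ratfun W" "independent_powers (ratdeg W)"
    using real_generator[of \<beta>1] real(1) assms(1) by blast
  show ?thesis
    using real_ratfun_of_generator[OF W real(1)] real_ratfun_of_generator[OF W real(2)] by blast
qed

end
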